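(* Let $P$ be a fully probabilistic program with observations, i.e. $P\in\mathsf{cpGCL}^{\boxtimes}$, let $f:\mathbb S\to[0,\infty]$, $g:\mathbb S\to[0,1]$, and let $\sigma\in\mathbb S$ be a state. Then $$\mathsf{CExpRew}^{\mathcal R_\sigma^{f}\llbracket P\rrbracket}(\lozenge\, sink\mid\neg\lozenge\,bad)=\underline{\mathsf{cwp}}[P](f)(\sigma),$$ $$\mathsf{CLExpRew}^{\mathcal R_\sigma^{g}\llbracket P\rrbracket}(\lozenge\, sink\mid\neg\lozenge\,bad)=\underline{\mathsf{cwlp}}[P](g)(\sigma),$$ where all four quantities are quotients; in each equation one side is undefined (zero denominator) if and only if the other is.
   Context: **Programs.** $\mathbb S$ is the set of program states (valuations of program variables). $\mathsf{cpGCL}^{\boxtimes}$ is the set of programs generated by $$P::=\mathtt{skip}\mid\mathtt{abort}\mid x:=E\mid \mathtt{observe}\,G\mid P;P\mid \mathtt{ite}(G)\{P\}\{P\}\mid\{P\}[p]\{P\}\mid\mathtt{while}(G)\{P\},$$ with $x$ a variable, $E$ an arithmetic expression, $G$ a Boolean expression over the variables, $p\in[0,1]$. **Expectations.** $\mathbb E=\{f:\mathbb S\to[0,\infty]\}$, $\mathbb E_{\le1}=\{g:\mathbb S\to[0,1]\}$, both ordered pointwise by $\sqsubseteq$. Constants $\mathbf 0,\mathbf 1$ are constant functions; $\chi_G$ is the $\{0,1\}$-valued indicator of $G$; $f[x/E](\sigma)=f(\sigma[x\leftarrow E(\sigma)])$; arithmetic is pointwise with $0\cdot\infty=0$. **Transformers.**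 $\mathsf{cwp}[P]:\mathbb E\times\mathbb E_{\le1}\to\mathbb E\times\mathbb E_{\le1}$ is defined inductively (sums and scalar multiples componentwise): $\mathsf{cwp}[\mathtt{skip}](f,g)=(f,g)$; $\mathsf{cwp}[\mathtt{abort}](f,g)=(\mathbf0,\mathbf1)$; $\mathsf{cwp}[x:=E](f,g)=(f[x/E],g[x/E])$; $\mathsf{cwp}[\mathtt{observe}\,G](f,g)=\chi_G\cdot(f,g)$; $\mathsf{cwp}[P_1;P_2]=\mathsf{cwp}[P_1]\circ\mathsf{cwp}[P_2]$; $\mathsf{cwp}[\mathtt{ite}(G)\{P_1\}\{P_2\}](f,g)=\chi_G\cdot\mathsf{cwp}[P_1](f,g)+\chi_{\neg G}\cdot\mathsf{cwp}[P_2](f,g)$; $\mathsf{cwp}[\{P_1\}[p]\{P_2\}](f,g)=p\cdot\mathsf{cwp}[P_1](f,g)+(1-p)\cdot\mathsf{cwp}[P_2](f,g)$; $\mathsf{cwp}[\mathtt{while}(G)\{P'\}](f,g)$ is the least fixed point, with respect to the order $(\sqsubseteq,\sqsupseteq)$ on $\mathbb E\times\mathbb E_{\le1}$, of $(\hat f,\hat g)\mapsto\chi_G\cdot\mathsf{cwp}[P'](\hat f,\hat g)+\chi_{\neg G}\cdot(f,g)$. $\mathsf{cwlp}[P]:\mathbb E_{\le1}\times\mathbb E_{\le1}\to\mathbb E_{\le1}\times\mathbb E_{\le1}$ is defined by the same rules (with $\mathsf{cwlp}$ in place of $\mathsf{cwp}$) except $\mathsf{cwlp}[\mathtt{abort}](f,g)=(\mathbf1,\mathbf1)$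 and $\mathsf{cwlp}[\mathtt{while}(G)\{P'\}](f,g)$ is the greatest fixed point w.r.t. $(\sqsubseteq,\sqsubseteq)$ of $(\hat f,\hat g)\mapsto\chi_G\cdot\mathsf{cwlp}[P'](\hat f,\hat g)+\chi_{\neg G}\cdot(f,g)$. Writing $\mathsf{cwp}_i,\mathsf{cwlp}_i$ for the $i$-th component, $$\underline{\mathsf{cwp}}[P](f)=\frac{\mathsf{cwp}_1[P](f,\mathbf1)}{\mathsf{cwp}_2[P](f,\mathbf1)},\qquad \underline{\mathsf{cwlp}}[P](f)=\frac{\mathsf{cwlp}_1[P](f,\mathbf1)}{\mathsf{cwlp}_2[P](f,\mathbf1)},$$ undefined at states where the denominator is $0$. **Operational Markov chain.** $\mathcal R_\sigma^f\llbracket P\rrbracket$ is the reward Markov chain with initial state $\langle P,\sigma\rangle$ whose states are of the form $\langle Q,\tau\rangle$ ($Q$ a program still to be executed, possibly of the form $\downarrow;Q'$), terminal states $\langle\downarrow,\tau\rangle$, and two special states $\langle bad\rangle$, $\langle sink\rangle$. Transitions (probability 1 unless stated): $\langle\downarrow,\tau\rangle\to\langle sink\rangle$; $\langle bad\rangle\to\langle sink\rangle$; $\langle sink\rangle\to\langle sink\rangle$; $\langle\mathtt{skip},\tau\rangle\to\langle\downarrow,\tau\rangle$; $\langle\mathtt{abort},\tau\rangle\to\langle\mathtt{abort},\tau\rangle$; $\langle x:=E,\tau\rangle\to\langle\downarrow,\tau[x\leftarrow E(\tau)]\rangle$; $\langle\mathtt{observe}\,G,\tau\rangle\to\langle\downarrow,\tau\rangle$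 if $\tau\models G$, $\to\langle bad\rangle$ otherwise; $\langle\downarrow;Q,\tau\rangle\to\langle Q,\tau\rangle$; if $\langle P,\tau\rangle\to\langle bad\rangle$ then $\langle P;Q,\tau\rangle\to\langle bad\rangle$; otherwise if $\langle P,\tau\rangle\to\mu$ then $\langle P;Q,\tau\rangle\to\nu$ with $\nu(\langle P';Q,\tau'\rangle)=\mu(\langle P',\tau'\rangle)$ for all $P'$ (including $P'=\downarrow$); $\langle\mathtt{ite}(G)\{P\}\{Q\},\tau\rangle\to\langle P,\tau\rangle$ if $\tau\models G$, $\to\langle Q,\tau\rangle$ otherwise; $\langle\mathtt{while}(G)\{P\},\tau\rangle\to\langle P;\mathtt{while}(G)\{P\},\tau\rangle$ if $\tau\models G$, $\to\langle\downarrow,\tau\rangle$ otherwise; $\langle\{P\}[p]\{Q\},\tau\rangle$ goes to $\langle P,\tau\rangle$ with probability $p$ and to $\langle Q,\tau\rangle$ with probability $1-p$ (added if the two states coincide). Rewards: $r(\langle\downarrow,\tau\rangle)=f(\tau)$, all other states have reward $0$. **Expected rewards.** $\lozenge\,sink$ is the set of finite paths from the initial state ending in $\langle sink\rangle$ at their first visit to it; $\neg\lozenge\,sink$ is the set of infinite paths never visiting $\langle sink\rangle$; $\neg\lozenge\,bad$ is the set of paths never visiting $\langle bad\rangle$. For a finite path $\hat\pi=s_0\dots s_n$, $r(\hat\pi)=\sum_{i<n}r(s_i)$ and $\Pr(\hat\pi)$ is the product of its transition probabilities; $\Pr$ extends to the usual measure on infinite paths. Then $$\mathsf{CExpRew}(\lozenge\,sink\mid\neg\lozenge\,bad)=\frac{\sum_{\hat\pi\in\lozenge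 sink,\ \hat\pi\text{ avoids }\langle bad\rangle}\Pr(\hat\pi)\,r(\hat\pi)}{\Pr(\neg\lozenge\,bad)},$$ $$\mathsf{CLExpRew}(\lozenge\,sink\mid\neg\lozenge\,bad)=\frac{\sum_{\hat\pi\in\lozenge sink,\ \hat\pi\text{ avoids }\langle bad\rangle}\Pr(\hat\pi)\,r(\hat\pi)+\Pr(\neg\lozenge\,sink)}{\Pr(\neg\lozenge\,bad)}.$$ *)

theory Defs
  imports "HOL-Probability.Probability"
begin

section \<open>Programs\<close>

type_synonym ('v, 'a) state = "'v \<Rightarrow> 'a"

text \<open>
  Expressions and guards are represented by their meaning as functions of the state.
  The type also contains the marker \<open>\<down>\<close> for a finished (sub)program, which occurs in
  configurations of the operational semantics such as \<open>\<down>; Q\<close> but is not part of the source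
  language; the source programs are the elements of the set \<open>cpGCL\<close> below.
\<close>

datatype ('v, 'a) prog =
    Down (\<open>\<down>\<close>)
  | Skip
  | Abort
  | Assign 'v "('v, 'a) state \<Rightarrow> 'a"
  | Observe "('v, 'a) state \<Rightarrow> bool"
  | Seq "('v, 'a) prog" "('v, 'a) prog"
  | Ite "('v, 'a) state \<Rightarrow> bool" "('v, 'a) prog" "('v, 'a) prog"
  | PChoice "('v, 'a) prog" real "('v, 'a) prog"
  | While "('v, 'a) state \<Rightarrow> bool" "('v, 'a) prog"

inductive_set cpGCL :: "('v, 'a) prog set" where
  "Skip \<in> cpGCL"
| "Abort \<in> cpGCL"
| "Assign x E \<in> cpGCL"
| "Observe G \<in> cpGCL"
| "P \<in> cpGCL \<Longrightarrow> Q \<in> cpGCL \<Longrightarrow> Seq P Q \<in> cpGCL"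
| "P \<in> cpGCL \<Longrightarrow> Q \<in> cpGCL \<Longrightarrow> Ite G P Q \<in> cpGCL"
| "P \<in> cpGCL \<Longrightarrow> Q \<in> cpGCL \<Longrightarrow> 0 \<le> p \<Longrightarrow> p \<le> 1 \<Longrightarrow> PChoice P p Q \<in> cpGCL"
| "P \<in> cpGCL \<Longrightarrow> While G P \<in> cpGCL"

section \<open>Expectations and conditional expectation transformers\<close>

type_synonym ('v, 'a) expectation = "('v, 'a) state \<Rightarrow> ennreal"

definition bounded_expectations :: "('v, 'a) expectation set" where
  "bounded_expectations = {g. \<forall>\<sigma>. g \<sigma> \<le> 1}"

definition chi :: "(('v, 'a) state \<Rightarrow> bool) \<Rightarrow> ('v, 'a) expectation" where
  "chi G = (\<lambda>\<sigma>. of_bool (G \<sigma>))"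

definition subst :: "'v \<Rightarrow> (('v, 'a) state \<Rightarrow> 'a) \<Rightarrow> ('v, 'a) expectation \<Rightarrow> ('v, 'a) expectation" where
  "subst x E f = (\<lambda>\<sigma>. f (\<sigma>(x := E \<sigma>)))"

definition scale2 :: "('v, 'a) expectation \<Rightarrow> ('v, 'a) expectation \<times> ('v, 'a) expectation
    \<Rightarrow> ('v, 'a) expectation \<times> ('v, 'a) expectation" where
  "scale2 w h = (\<lambda>\<sigma>. w \<sigma> * fst h \<sigma>, \<lambda>\<sigma>. w \<sigma> * snd h \<sigma>)"

definition add2 :: "('v, 'a) expectation \<times> ('v, 'a) expectation
    \<Rightarrow> ('v, 'a) expectation \<times> ('v, 'a) expectation
    \<Rightarrow> ('v, 'a) expectation \<times> ('v, 'a) expectation" where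
  "add2 h h' = (\<lambda>\<sigma>. fst h \<sigma> + fst h' \<sigma>, \<lambda>\<sigma>. snd h \<sigma> + snd h' \<sigma>)"

text \<open>The least and the greatest fixed point of \<open>F\<close> among the elements of \<open>A\<close>,
  with respect to the order \<open>le\<close>.\<close>

definition least_fixpoint :: "'b set \<Rightarrow> ('b \<Rightarrow> 'b \<Rightarrow> bool) \<Rightarrow> ('b \<Rightarrow> 'b) \<Rightarrow> 'b" where
  "least_fixpoint A le F = (THE h. h \<in> A \<and> F h = h \<and> (\<forall>h'\<in>A. F h' = h' \<longrightarrow> le h h'))"

definition greatest_fixpoint :: "'b set \<Rightarrow> ('b \<Rightarrow> 'b \<Rightarrow> bool) \<Rightarrow> ('b \<Rightarrow> 'b) \<Rightarrow> 'b" where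
  "greatest_fixpoint A le F = (THE h. h \<in> A \<and> F h = h \<and> (\<forall>h'\<in>A. F h' = h' \<longrightarrow> le h' h))"

definition le_cwp :: "('v, 'a) expectation \<times> ('v, 'a) expectation
    \<Rightarrow> ('v, 'a) expectation \<times> ('v, 'a) expectation \<Rightarrow> bool" where
  "le_cwp h h' \<longleftrightarrow> fst h \<le> fst h' \<and> snd h' \<le> snd h"

definition le_cwlp :: "('v, 'a) expectation \<times> ('v, 'a) expectation
    \<Rightarrow> ('v, 'a) expectation \<times> ('v, 'a) expectation \<Rightarrow> bool" where
  "le_cwlp h h' \<longleftrightarrow> fst h \<le> fst h' \<and> snd h \<le> snd h'"

text \<open>
  The transformers are total on pairs of \<^typ>\<open>ennreal\<close>-valued functions; they are meaningful on
  pairs whose second component (for \<open>cwlp\<close>: both components) is bounded by 1, and the fixed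
  points are taken among such pairs only. The equations for \<^term>\<open>\<down>\<close> are never
  reached from source programs.
\<close>

primrec cwp :: "('v, 'a) prog \<Rightarrow> ('v, 'a) expectation \<times> ('v, 'a) expectation
    \<Rightarrow> ('v, 'a) expectation \<times> ('v, 'a) expectation" where
  "cwp \<down> h = h"
| "cwp Skip h = h"
| "cwp Abort h = (\<lambda>_. 0, \<lambda>_. 1)"
| "cwp (Assign x E) h = map_prod (subst x E) (subst x E) h"
| "cwp (Observe G) h = scale2 (chi G) h"
| "cwp (Seq P Q) h = cwp P (cwp Q h)"
| "cwp (Ite G P Q) h =
     add2 (scale2 (chi G) (cwp P h)) (scale2 (chi (\<lambda>\<sigma>. \<not> G \<sigma>)) (cwp Q h))"
| "cwp (PChoice P p Q) h =
     add2 (scale2 (\<lambda>_. ennreal p) (cwp P h)) (scale2 (\<lambda>_. ennreal (1 - p)) (cwp Q h))"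
| "cwp (While G P) h =
     least_fixpoint (UNIV \<times> bounded_expectations) le_cwp
       (\<lambda>X. add2 (scale2 (chi G) (cwp P X)) (scale2 (chi (\<lambda>\<sigma>. \<not> G \<sigma>)) h))"

primrec cwlp :: "('v, 'a) prog \<Rightarrow> ('v, 'a) expectation \<times> ('v, 'a) expectation
    \<Rightarrow> ('v, 'a) expectation \<times> ('v, 'a) expectation" where
  "cwlp \<down> h = h"
| "cwlp Skip h = h"
| "cwlp Abort h = (\<lambda>_. 1, \<lambda>_. 1)"
| "cwlp (Assign x E) h = map_prod (subst x E) (subst x E) h"
| "cwlp (Observe G) h = scale2 (chi G) h"
| "cwlp (Seq P Q) h = cwlp P (cwlp Q h)"
| "cwlp (Ite G P Q) h =
     add2 (scale2 (chi G) (cwlp P h)) (scale2 (chi (\<lambda>\<sigma>. \<not> G \<sigma>)) (cwlp Q h))"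
| "cwlp (PChoice P p Q) h =
     add2 (scale2 (\<lambda>_. ennreal p) (cwlp P h)) (scale2 (\<lambda>_. ennreal (1 - p)) (cwlp Q h))"
| "cwlp (While G P) h =
     greatest_fixpoint (bounded_expectations \<times> bounded_expectations) le_cwlp
       (\<lambda>X. add2 (scale2 (chi G) (cwlp P X)) (scale2 (chi (\<lambda>\<sigma>. \<not> G \<sigma>)) h))"

text \<open>A quotient is undefined, i.e. \<^term>\<open>None\<close>, exactly if its denominator is 0.\<close>

definition quotient :: "ennreal \<Rightarrow> ennreal \<Rightarrow> ennreal option" where
  "quotient a b = (if b = 0 then None else Some (a / b))"

definition ucwp :: "('v, 'a) prog \<Rightarrow> ('v, 'a) expectation \<Rightarrow> ('v, 'a) state \<Rightarrow> ennreal option" where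
  "ucwp P f \<sigma> = quotient (fst (cwp P (f, \<lambda>_. 1)) \<sigma>) (snd (cwp P (f, \<lambda>_. 1)) \<sigma>)"

definition ucwlp :: "('v, 'a) prog \<Rightarrow> ('v, 'a) expectation \<Rightarrow> ('v, 'a) state \<Rightarrow> ennreal option" where
  "ucwlp P f \<sigma> = quotient (fst (cwlp P (f, \<lambda>_. 1)) \<sigma>) (snd (cwlp P (f, \<lambda>_. 1)) \<sigma>)"

section \<open>Conditional expected rewards in Markov chains\<close>

text \<open>
  A Markov chain is given by its transition function \<open>K :: 's \<Rightarrow> 's pmf\<close> and an initial state \<open>s\<close>.
  Its measure on infinite paths is the Ionescu-Tulcea limit: step \<open>0\<close> yields \<open>s\<close>, and step
  \<open>Suc n\<close> is distributed according to \<open>K\<close> at the \<open>n\<close>-th state.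
\<close>

definition step_kernel :: "('s \<Rightarrow> 's pmf) \<Rightarrow> 's \<Rightarrow> nat \<Rightarrow> (nat \<Rightarrow> 's) \<Rightarrow> 's measure" where
  "step_kernel K s i \<omega> =
     measure_pmf (case i of 0 \<Rightarrow> return_pmf s | Suc n \<Rightarrow> K (\<omega> n))"

lemma Ionescu_Tulcea_step_kernel:
  fixes K :: "'s \<Rightarrow> 's pmf"
  shows "Ionescu_Tulcea (step_kernel K s) (\<lambda>_. count_space UNIV)"
proof (rule Ionescu_Tulcea.intro)
  fix i
  show "step_kernel K s i \<in>
      measurable (PiM {0..<i} (\<lambda>_. count_space UNIV)) (subprob_algebra (count_space UNIV))"
  proof (cases i)
    case 0
    then show ?thesis
      by (simp add: step_kernel_def [abs_def] space_subprob_algebra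
            prob_space_imp_subprob_space measure_pmf.prob_space_axioms)
  next
    case (Suc n)
    have "(\<lambda>\<omega>. \<omega> n) \<in> measurable (PiM {0..<i} (\<lambda>_. count_space UNIV)) (count_space UNIV)"
      using Suc measurable_component_singleton[of n "{0..<i}" "\<lambda>_. count_space UNIV"] by simp
    moreover have "(\<lambda>t. measure_pmf (K t)) \<in>
        measurable (count_space UNIV) (subprob_algebra (count_space UNIV))"
      by (simp add: space_subprob_algebra prob_space_imp_subprob_space
            measure_pmf.prob_space_axioms)
    ultimately have "(\<lambda>\<omega>. measure_pmf (K (\<omega> n))) \<in>
        measurable (PiM {0..<i} (\<lambda>_. count_space UNIV)) (subprob_algebra (count_space UNIV))"
      by (rule measurable_compose)
    then show ?thesis
      using Suc by (simp add: step_kernel_def [abs_def])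
  qed
next
  fix i :: nat and x :: "nat \<Rightarrow> 's"
  show "prob_space (step_kernel K s i x)"
    by (simp add: step_kernel_def measure_pmf.prob_space_axioms)
qed

definition path_measure :: "('s \<Rightarrow> 's pmf) \<Rightarrow> 's \<Rightarrow> (nat \<Rightarrow> 's) measure" where
  "path_measure K s =
     projective_family.lim UNIV
       (Ionescu_Tulcea.CI (step_kernel K s) (\<lambda>_. count_space UNIV)) (\<lambda>_. count_space UNIV)"

text \<open>
  The probability of never visiting a state \<open>t\<close>. The event is not restricted to sequences all of
  whose transitions have positive probability: over an uncountable state space this restriction
  need not be measurable, and it concerns a null set only.
\<close>

definition pr_never :: "('s \<Rightarrow> 's pmf) \<Rightarrow> 's \<Rightarrow> 's \<Rightarrow> ennreal" where
  "pr_never K s t = emeasure (path_measure K s) {\<omega>. \<forall>n. \<omega> n \<noteq> t}"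

definition first_visit_paths :: "('s \<Rightarrow> 's pmf) \<Rightarrow> 's \<Rightarrow> 's \<Rightarrow> 's list set" where
  "first_visit_paths K s t =
     {\<pi>. \<pi> \<noteq> [] \<and> hd \<pi> = s \<and> last \<pi> = t \<and> t \<notin> set (butlast \<pi>) \<and>
         successively (\<lambda>u v. v \<in> set_pmf (K u)) \<pi>}"

definition path_prob :: "('s \<Rightarrow> 's pmf) \<Rightarrow> 's list \<Rightarrow> ennreal" where
  "path_prob K \<pi> = (\<Prod>i<length \<pi> - 1. ennreal (pmf (K (\<pi> ! i)) (\<pi> ! Suc i)))"

definition path_reward :: "('s \<Rightarrow> ennreal) \<Rightarrow> 's list \<Rightarrow> ennreal" where
  "path_reward r \<pi> = (\<Sum>i<length \<pi> - 1. r (\<pi> ! i))"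

text \<open>In the following two definitions \<open>t\<close> is the target state and \<open>b\<close> the state to be avoided.\<close>

definition CExpRew :: "('s \<Rightarrow> 's pmf) \<Rightarrow> ('s \<Rightarrow> ennreal) \<Rightarrow> 's \<Rightarrow> 's \<Rightarrow> 's \<Rightarrow> ennreal option" where
  "CExpRew K r s t b =
     quotient
       (\<Sum>\<^sub>\<infinity>\<pi> | \<pi> \<in> first_visit_paths K s t \<and> b \<notin> set \<pi>. path_prob K \<pi> * path_reward r \<pi>)
       (pr_never K s b)"

definition CLExpRew :: "('s \<Rightarrow> 's pmf) \<Rightarrow> ('s \<Rightarrow> ennreal) \<Rightarrow> 's \<Rightarrow> 's \<Rightarrow> 's \<Rightarrow> ennreal option" where
  "CLExpRew K r s t b =
     quotient
       ((\<Sum>\<^sub>\<infinity>\<pi> | \<pi> \<in> first_visit_paths K s t \<and> b \<notin> set \<pi>. path_prob K \<pi> * path_reward r \<pi>)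
         + pr_never K s t)
       (pr_never K s b)"

section \<open>Operational Markov chain of a program\<close>

datatype ('v, 'a) config = Conf "('v, 'a) prog" "('v, 'a) state" | Bad | Sink

fun append_prog :: "('v, 'a) prog \<Rightarrow> ('v, 'a) config \<Rightarrow> ('v, 'a) config" where
  "append_prog Q (Conf P \<sigma>) = Conf (Seq P Q) \<sigma>"
| "append_prog Q Bad = Bad"
| "append_prog Q Sink = Sink"

text \<open>
  In the equation for \<^const>\<open>Seq\<close>, the configuration \<open>Sink\<close> is never a successor of \<open>P\<close>, since only
  \<^term>\<open>\<down>\<close> itself moves there.
\<close>

primrec prog_step :: "('v, 'a) prog \<Rightarrow> ('v, 'a) state \<Rightarrow> ('v, 'a) config pmf" where
  "prog_step \<down> \<sigma> = return_pmf Sink"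
| "prog_step Skip \<sigma> = return_pmf (Conf \<down> \<sigma>)"
| "prog_step Abort \<sigma> = return_pmf (Conf Abort \<sigma>)"
| "prog_step (Assign x E) \<sigma> = return_pmf (Conf \<down> (\<sigma>(x := E \<sigma>)))"
| "prog_step (Observe G) \<sigma> = return_pmf (if G \<sigma> then Conf \<down> \<sigma> else Bad)"
| "prog_step (Seq P Q) \<sigma> =
     (if P = \<down> then return_pmf (Conf Q \<sigma>) else map_pmf (append_prog Q) (prog_step P \<sigma>))"
| "prog_step (Ite G P Q) \<sigma> = return_pmf (if G \<sigma> then Conf P \<sigma> else Conf Q \<sigma>)"
| "prog_step (PChoice P p Q) \<sigma> =
     map_pmf (\<lambda>b. if b then Conf P \<sigma> else Conf Q \<sigma>) (bernoulli_pmf p)"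
| "prog_step (While G P) \<sigma> =
     return_pmf (if G \<sigma> then Conf (Seq P (While G P)) \<sigma> else Conf \<down> \<sigma>)"

primrec config_step :: "('v, 'a) config \<Rightarrow> ('v, 'a) config pmf" where
  "config_step (Conf P \<sigma>) = prog_step P \<sigma>"
| "config_step Bad = return_pmf Sink"
| "config_step Sink = return_pmf Sink"

primrec reward :: "('v, 'a) expectation \<Rightarrow> ('v, 'a) config \<Rightarrow> ennreal" where
  "reward f (Conf P \<sigma>) = (if P = \<down> then f \<sigma> else 0)"
| "reward f Bad = 0"
| "reward f Sink = 0"

end

theory Submission
  imports Defs
begin

text \<open>
  All quantities are limits of iterates of one Bellman operator on configurations, which maps
  \<open>\<langle>\<down>,\<tau>\<rangle>\<close> to \<open>f \<tau>\<close>, the special states to 0, and averages over the successors elsewhere.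
  The rewards of paths of bounded length are its iterates from 0. The denominator and the liberal
  numerator are both limits of its iterates from 1, with \<open>f = 1\<close> and \<open>f = g\<close> respectively, since
  a run avoids \<open>bad\<close> iff it terminates properly or diverges.
  On the program side, \<open>cwp\<close> and \<open>cwlp\<close> act on the two components independently, as a weakest
  (liberal) preexpectation. It remains to see that the two limits are compositional in
  the program; for a loop, the iterates at \<open>P; while(G){P}\<close> are compared with the nested iterates,
  which yields the extremality of the limit among the fixed points.
\<close>

section \<open>Avoidance probabilities in Markov chains\<close>

text \<open>The transition operator of the chain killed at \<open>t\<close>. The test concerns the
  current state, so the n-th iterate applied to \<open>h\<close> is the mean of \<open>h\<close> at
  step n over the runs that miss \<open>t\<close> at all earlier steps.\<close>

definition avoid_step :: "('s \<Rightarrow> 's pmf) \<Rightarrow> 's \<Rightarrow> ('s \<Rightarrow> ennreal) \<Rightarrow> 's \<Rightarrow> ennreal" where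
  "avoid_step K t h x = (if x = t then 0 else \<integral>\<^sup>+ y. h y \<partial>measure_pmf (K x))"

text \<open>Integrating out the last coordinate replaces \<open>h\<close> by
  \<open>avoid_step K t h\<close> and shortens the prefix by one, so the induction keeps
  \<open>h\<close> general. Coordinate 0 is itself drawn, from the point mass at \<open>s\<close>,
  so n transitions take \<open>Suc n\<close> kernel steps.\<close>

lemma nn_integral_step_kernel_prefix:
  fixes K :: "'s \<Rightarrow> 's pmf" and h :: "'s \<Rightarrow> ennreal"
  shows "(\<integral>\<^sup>+ \<omega>. (\<Prod>i<n. of_bool (\<omega> i \<noteq> t)) * h (\<omega> n)
      \<partial>Ionescu_Tulcea.C (step_kernel K s) (\<lambda>_. count_space UNIV) 0 (Suc n) (\<lambda>_. undefined))
    = (avoid_step K t ^^ n) h s"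
proof -
  interpret IT: Ionescu_Tulcea "step_kernel K s" "\<lambda>_. count_space UNIV"
    by (rule Ionescu_Tulcea_step_kernel)
  have und: "(\<lambda>_. undefined) \<in> space (PiM {0..<0} (\<lambda>_. count_space UNIV))"
    by (simp add: space_PiM PiE_iff extensional_def)
  have comp: "(\<lambda>\<omega>. g (\<omega> i)) \<in> borel_measurable (PiM {0..<Suc n} (\<lambda>_. count_space UNIV))"
    if "i \<le> n" for i n and g :: "'s \<Rightarrow> ennreal"
    using that measurable_compose[OF measurable_component_singleton[of i "{0..<Suc n}" "\<lambda>_. count_space UNIV"], of g borel]
    by simp
  have meas: "(\<lambda>\<omega>. (\<Prod>i<n. of_bool (\<omega> i \<noteq> t)) * h (\<omega> n))
      \<in> borel_measurable (PiM {0..<Suc n} (\<lambda>_. count_space UNIV))" for n and h :: "'s \<Rightarrow> ennreal"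
    by (intro borel_measurable_times_ennreal borel_measurable_prod_ennreal comp[of _ n "\<lambda>x. of_bool (x \<noteq> t)"] comp) auto
  have step: "(\<integral>\<^sup>+ \<omega>. f \<omega> \<partial>IT.C 0 (Suc n) (\<lambda>_. undefined))
      = (\<integral>\<^sup>+ \<omega>. \<integral>\<^sup>+ y. f (fun_upd \<omega> n y) \<partial>step_kernel K s n \<omega> \<partial>IT.C 0 n (\<lambda>_. undefined))"
    if "f \<in> borel_measurable (PiM {0..<Suc n} (\<lambda>_. count_space UNIV))" for f n
  proof -
    have "sets (IT.C 0 n (\<lambda>_. undefined)) = sets (PiM {0..<n} (\<lambda>_. count_space UNIV))"
      using IT.sets_C[OF und, of n] by simp
    then have eP: "IT.eP n \<in> measurable (IT.C 0 n (\<lambda>_. undefined))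
        (subprob_algebra (PiM {0..<Suc n} (\<lambda>_. count_space UNIV)))"
      using IT.measurable_eP[of n] by (simp cong: measurable_cong_sets)
    have "(\<integral>\<^sup>+ \<omega>. f \<omega> \<partial>IT.C 0 (Suc n) (\<lambda>_. undefined))
        = (\<integral>\<^sup>+ \<omega>. \<integral>\<^sup>+ \<omega>'. f \<omega>' \<partial>IT.eP n \<omega> \<partial>IT.C 0 n (\<lambda>_. undefined))"
      using nn_integral_bind[OF that eP] by simp
    also have "\<dots> = (\<integral>\<^sup>+ \<omega>. \<integral>\<^sup>+ y. f (fun_upd \<omega> n y) \<partial>step_kernel K s n \<omega> \<partial>IT.C 0 n (\<lambda>_. undefined))"
      using that IT.space_C[OF und, of n] by (intro nn_integral_cong) (simp add: IT.nn_integral_eP)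
    finally show ?thesis .
  qed
  show ?thesis
  proof (induction n arbitrary: h)
    case 0
    have "(\<integral>\<^sup>+ \<omega>. h (\<omega> 0) \<partial>IT.C 0 (Suc 0) (\<lambda>_. undefined))
        = (\<integral>\<^sup>+ \<omega>. h s \<partial>IT.C 0 0 (\<lambda>_. undefined))"
      using meas[of 0 h] by (subst step) (simp_all add: step_kernel_def)
    also have "\<dots> = h s"
      using IT.prob_space_C[OF und, of 0] by (simp add: prob_space.emeasure_space_1)
    finally show ?case by simp
  next
    case (Suc n)
    have "(\<integral>\<^sup>+ \<omega>. (\<Prod>i<Suc n. of_bool (\<omega> i \<noteq> t)) * h (\<omega> (Suc n)) \<partial>IT.C 0 (Suc (Suc n)) (\<lambda>_. undefined))
        = (\<integral>\<^sup>+ \<omega>. \<integral>\<^sup>+ y. (\<Prod>i<Suc n. of_bool (\<omega> i \<noteq> t)) * h y \<partial>measure_pmf (K (\<omega> n))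
             \<partial>IT.C 0 (Suc n) (\<lambda>_. undefined))"
      by (subst step[OF meas]) (simp add: step_kernel_def)
    \<comment> \<open>The factor with index n depends on the prefix only; together with the inner
      integral it forms \<open>avoid_step K t h\<close> at \<open>\<omega> n\<close>.\<close>
    also have "\<dots> = (\<integral>\<^sup>+ \<omega>. (\<Prod>i<n. of_bool (\<omega> i \<noteq> t)) * avoid_step K t h (\<omega> n)
             \<partial>IT.C 0 (Suc n) (\<lambda>_. undefined))"
      by (intro nn_integral_cong) (simp add: nn_integral_cmult avoid_step_def)
    also have "\<dots> = (avoid_step K t ^^ n) (avoid_step K t h) s"
      by (rule Suc.IH)
    finally show ?case by (simp add: funpow_swap1)
  qed
qed

text \<open>The event is the decreasing intersection of the cylinders \<open>A n\<close>, so
  continuity from above applies. The iterated operator tests the steps before n, the starting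
  function tests step n.\<close>

lemma pr_never_eq_INF:
  "pr_never K s t = (INF n. (avoid_step K t ^^ n) (\<lambda>x. of_bool (x \<noteq> t)) s)"
proof -
  interpret IT: Ionescu_Tulcea "step_kernel K s" "\<lambda>_. count_space UNIV"
    by (rule Ionescu_Tulcea_step_kernel)
  define A where "A n = {\<omega>. \<forall>i\<le>n. \<omega> i \<noteq> t}" for n :: nat
  define B where "B n = {\<omega> \<in> space (PiM {0..<Suc n} (\<lambda>_. count_space UNIV)). \<forall>i\<le>n. \<omega> i \<noteq> t}" for n :: nat
  have und: "(\<lambda>_. undefined) \<in> space (PiM {0..<0} (\<lambda>_. count_space UNIV))"
    by (simp add: space_PiM PiE_iff extensional_def)
  have B_eq: "B n = PiE {0..<Suc n} (\<lambda>_. - {t})" for n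
    by (auto simp: B_def space_PiM PiE_iff extensional_def less_Suc_eq_le)
  have B_sets: "B n \<in> sets (PiM {0..<Suc n} (\<lambda>_. count_space UNIV))" for n
    unfolding B_eq by (rule sets_PiM_I_finite) auto
  have emb: "A n = prod_emb UNIV (\<lambda>_. count_space UNIV) {0..<Suc n} (B n)" for n
    by (auto simp: A_def B_eq prod_emb_def space_PiM PiE_iff less_Suc_eq_le)
  have A_sets: "A n \<in> sets IT.PF.lim" for n
    unfolding emb IT.PF.sets_lim by (rule measurable_prod_emb) (auto intro: B_sets)
  have em: "emeasure IT.PF.lim (A n) = (avoid_step K t ^^ n) (\<lambda>x. of_bool (x \<noteq> t)) s" for n
  proof -
    have "emeasure IT.PF.lim (A n) = emeasure (IT.CI {0..<Suc n}) (B n)"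
      unfolding emb by (rule IT.lim) (auto intro: B_sets)
    also have "\<dots> = emeasure (IT.C 0 (Suc n) (\<lambda>_. undefined)) (B n)"
      using B_sets[of n] by (subst IT.emeasure_CI[where n="Suc n"]) (auto simp: prod_emb_id B_eq)
    also have "\<dots> = (\<integral>\<^sup>+ \<omega>. indicator (B n) \<omega> \<partial>IT.C 0 (Suc n) (\<lambda>_. undefined))"
      using B_sets[of n] IT.sets_C[OF und, of "Suc n"] by simp
    also have "\<dots> = (\<integral>\<^sup>+ \<omega>. (\<Prod>i<n. of_bool (\<omega> i \<noteq> t)) * of_bool (\<omega> n \<noteq> t) \<partial>IT.C 0 (Suc n) (\<lambda>_. undefined))"
      using IT.space_C[OF und, of "Suc n"]
      by (intro nn_integral_cong)
         (auto simp: B_def prod_zero_iff le_less less_Suc_eq split: split_indicator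
           simp del: IT.C.simps)
    also have "\<dots> = (avoid_step K t ^^ n) (\<lambda>x. of_bool (x \<noteq> t)) s"
      by (rule nn_integral_step_kernel_prefix)
    finally show ?thesis .
  qed
  have "emeasure IT.PF.lim (A n) \<le> 1" for n
    using emb[of n] IT.lim[of "{0..<Suc n}" "B n"] B_sets[of n]
      prob_space.emeasure_le_1[OF IT.PF.prob_space_P, of "{0..<Suc n}" "B n"] by simp
  then have fin: "emeasure IT.PF.lim (A n) \<noteq> \<infinity>" for n
    by (metis infinity_ennreal_def ennreal_one_neq_top top.extremum_uniqueI)
  have "emeasure IT.PF.lim (\<Inter>n. A n) = (INF n. emeasure IT.PF.lim (A n))"
    using A_sets fin by (intro INF_emeasure_decseq[symmetric]) (auto simp: decseq_def A_def intro: order_trans)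
  moreover have "(\<Inter>n. A n) = {\<omega>. \<forall>n. \<omega> n \<noteq> t}" by (auto simp: A_def)
  ultimately show ?thesis
    by (simp add: pr_never_def path_measure_def em)
qed

section \<open>Rewards of paths of bounded length\<close>

text \<open>Makes Tonelli available for path sums, whose index sets may be uncountable. In the
  harder direction, a simple function below \<open>f\<close> either has finite support or, by the
  pigeonhole principle, takes some nonzero value infinitely often, and then the sum is
  infinite.\<close>

lemma infsum_ennreal_eq_nn_integral:
  fixes f :: "'b \<Rightarrow> ennreal"
  shows "infsum f A = (\<integral>\<^sup>+ x. f x \<partial>count_space A)"
proof (rule antisym)
  have "sum f F \<le> (\<integral>\<^sup>+ x. f x \<partial>count_space A)" if "finite F" "F \<subseteq> A" for F
  proof -
    have "sum f F = (\<integral>\<^sup>+ x. f x * indicator F x \<partial>count_space A)"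
      using that by (subst nn_integral_count_space'[where A=F]) auto
    also have "\<dots> \<le> (\<integral>\<^sup>+ x. f x \<partial>count_space A)"
      by (intro nn_integral_mono) (auto split: split_indicator)
    finally show ?thesis .
  qed
  then show "infsum f A \<le> (\<integral>\<^sup>+ x. f x \<partial>count_space A)"
    by (auto simp: nonneg_infsum_complete intro!: SUP_least)
next
  have "(\<integral>\<^sup>S x. g x \<partial>count_space A) \<le> infsum f A"
    if g: "simple_function (count_space A) g" "g \<le> f" for g
  proof (cases "finite {x\<in>A. g x \<noteq> 0}")
    case True
    have "(\<integral>\<^sup>S x. g x \<partial>count_space A) = (\<integral>\<^sup>+ x. g x \<partial>count_space A)"
      using g by (simp add: nn_integral_eq_simple_integral)
    also have "\<dots> = (\<Sum>x\<in>{x\<in>A. g x \<noteq> 0}. g x)"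
      using True by (intro nn_integral_count_space') auto
    also have "\<dots> \<le> (\<Sum>x\<in>{x\<in>A. g x \<noteq> 0}. f x)"
      using g by (intro sum_mono) (auto simp: le_fun_def)
    also have "\<dots> \<le> infsum f A"
      using True by (auto simp: nonneg_infsum_complete intro!: SUP_upper)
    finally show ?thesis .
  next
    case False
    have "finite (g ` {x\<in>A. g x \<noteq> 0})"
      using g by (auto elim!: finite_subset[rotated])
    from pigeonhole_infinite[OF False this] obtain a
      where a: "a \<in> A" "g a \<noteq> 0" "infinite {x\<in>A. g x \<noteq> 0 \<and> g x = g a}"
      by auto
    let ?B = "{x\<in>A. g x = g a}"
    have "{x\<in>A. g x \<noteq> 0 \<and> g x = g a} = ?B" using a by auto
    then have "infsum f ?B = \<infinity>"
      using a g(2)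
      by (intro infsum_superconst_infinite_ennreal[where b="g a"])
         (auto simp: le_fun_def zero_less_iff_neq_zero, metis)
    moreover have "infsum f ?B \<le> infsum f A"
      by (intro infsum_mono_neutral nonneg_summable_on_complete) auto
    ultimately show ?thesis by (simp add: top_unique)
  qed
  then show "(\<integral>\<^sup>+ x. f x \<partial>count_space A) \<le> infsum f A"
    unfolding nn_integral_def by (auto intro!: SUP_least)
qed

section \<open>First-step analysis of truncated path sums\<close>

text \<open>\<open>length\<close> counts states, so the bound \<open>Suc n\<close> admits at most n
  transitions.\<close>

definition bounded_visit_paths :: "('s \<Rightarrow> 's pmf) \<Rightarrow> 's \<Rightarrow> 's \<Rightarrow> nat \<Rightarrow> 's \<Rightarrow> 's list set" where
  "bounded_visit_paths K t b n s = {\<pi> \<in> first_visit_paths K s t. b \<notin> set \<pi> \<and> length \<pi> \<le> Suc n}"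

definition bounded_reward :: "('s \<Rightarrow> 's pmf) \<Rightarrow> ('s \<Rightarrow> ennreal) \<Rightarrow> 's \<Rightarrow> 's \<Rightarrow> nat \<Rightarrow> 's \<Rightarrow> ennreal" where
  "bounded_reward K r t b n s =
     (\<Sum>\<^sub>\<infinity>\<pi>\<in>bounded_visit_paths K t b n s. path_prob K \<pi> * path_reward r \<pi>)"

lemma path_prob_Cons:
  "\<pi> \<noteq> [] \<Longrightarrow> path_prob K (x # \<pi>) = ennreal (pmf (K x) (hd \<pi>)) * path_prob K \<pi>"
  by (cases \<pi>) (simp_all add: path_prob_def prod.lessThan_Suc_shift del: prod.lessThan_Suc)

lemma path_reward_Cons:
  "\<pi> \<noteq> [] \<Longrightarrow> path_reward r (x # \<pi>) = r x + path_reward r \<pi>"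
  by (cases \<pi>) (simp_all add: path_reward_def sum.lessThan_Suc_shift del: sum.lessThan_Suc)

lemma Cons_first_visit_paths_iff:
  assumes "x \<noteq> t"
  shows "x # \<pi> \<in> first_visit_paths K s t \<longleftrightarrow>
     s = x \<and> \<pi> \<noteq> [] \<and> hd \<pi> \<in> set_pmf (K x) \<and> \<pi> \<in> first_visit_paths K (hd \<pi>) t"
  using assms by (cases \<pi>) (auto simp: first_visit_paths_def)

text \<open>The unordered sum is the supremum of its finite partial sums, and finitely many paths
  have bounded length.\<close>

lemma bounded_reward_SUP:
  "(\<Sum>\<^sub>\<infinity>\<pi> | \<pi> \<in> first_visit_paths K s t \<and> b \<notin> set \<pi>. path_prob K \<pi> * path_reward r \<pi>)
     = (SUP n. bounded_reward K r t b n s)"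
proof (rule antisym)
  let ?w = "\<lambda>\<pi>. path_prob K \<pi> * path_reward r \<pi>"
  have "sum ?w F \<le> (SUP n. bounded_reward K r t b n s)"
    if "finite F" "F \<subseteq> {\<pi>. \<pi> \<in> first_visit_paths K s t \<and> b \<notin> set \<pi>}" for F
  proof -
    \<comment> \<open>For empty \<open>F\<close> the value of \<open>Max\<close> is unspecified, but
      the inclusion below is then trivial.\<close>
    define n where "n = Max (length ` F)"
    have "F \<subseteq> bounded_visit_paths K t b n s"
      using that by (auto simp: bounded_visit_paths_def n_def intro!: le_SucI)
    then have "sum ?w F \<le> bounded_reward K r t b n s"
      using that by (auto simp: bounded_reward_def nonneg_infsum_complete intro!: SUP_upper)
    also have "\<dots> \<le> (SUP n. bounded_reward K r t b n s)"
      by (rule SUP_upper) simp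
    finally show ?thesis .
  qed
  then show "infsum ?w {\<pi>. \<pi> \<in> first_visit_paths K s t \<and> b \<notin> set \<pi>}
      \<le> (SUP n. bounded_reward K r t b n s)"
    by (auto simp: nonneg_infsum_complete[of "{\<pi>. \<pi> \<in> first_visit_paths K s t \<and> b \<notin> set \<pi>}"]
        intro!: SUP_least)
  show "(SUP n. bounded_reward K r t b n s)
      \<le> infsum ?w {\<pi>. \<pi> \<in> first_visit_paths K s t \<and> b \<notin> set \<pi>}"
    unfolding bounded_reward_def
    by (intro SUP_least infsum_mono_neutral nonneg_summable_on_complete) (auto simp: bounded_visit_paths_def)
qed

lemma bounded_reward_0: "bounded_reward K r t b 0 s = 0"
proof -
  have "path_reward r \<pi> = 0" if "\<pi> \<in> bounded_visit_paths K t b 0 s" for \<pi>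
    using that by (cases \<pi>) (auto simp: bounded_visit_paths_def path_reward_def)
  then have "bounded_reward K r t b 0 s = (\<Sum>\<^sub>\<infinity>\<pi>\<in>bounded_visit_paths K t b 0 s. 0)"
    unfolding bounded_reward_def by (intro infsum_cong) simp
  then show ?thesis by simp
qed

lemma bounded_reward_target: "bounded_reward K r t b n t = 0"
proof -
  have "path_reward r \<pi> = 0" if "\<pi> \<in> bounded_visit_paths K t b n t" for \<pi>
    using that by (cases \<pi>) (auto simp: bounded_visit_paths_def first_visit_paths_def path_reward_def
        split: if_splits)
  then have "bounded_reward K r t b n t = (\<Sum>\<^sub>\<infinity>\<pi>\<in>bounded_visit_paths K t b n t. 0)"
    unfolding bounded_reward_def by (intro infsum_cong) simp
  then show ?thesis by simp
qed

lemma bounded_reward_avoided: "bounded_reward K r t b n b = 0"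
proof -
  have "bounded_visit_paths K t b n b = {}"
    by (auto simp: bounded_visit_paths_def first_visit_paths_def)
  then show ?thesis by (simp add: bounded_reward_def)
qed

lemma bounded_reward_exit:
  assumes "K x = return_pmf t" "x \<noteq> t" "x \<noteq> b" "t \<noteq> b"
  shows "bounded_reward K r t b (Suc n) x = r x"
proof -
  have "bounded_visit_paths K t b (Suc n) x = {[x, t]}"
  proof (rule set_eqI)
    fix \<pi>
    show "\<pi> \<in> bounded_visit_paths K t b (Suc n) x \<longleftrightarrow> \<pi> \<in> {[x, t]}"
    proof (cases \<pi>)
      case Nil
      then show ?thesis by (simp add: bounded_visit_paths_def first_visit_paths_def)
    next
      case (Cons y \<rho>)
      then show ?thesis
        using assms
        by (cases \<rho>) (auto simp: bounded_visit_paths_def first_visit_paths_def split: if_splits)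
    qed
  qed
  then show ?thesis
    using assms by (simp add: bounded_reward_def path_prob_def path_reward_def)
qed

text \<open>Since \<open>x\<close> carries no reward, prefixing it to a path multiplies the
  probability by that of the first transition and leaves the reward as it is.\<close>

lemma bounded_reward_step:
  fixes K :: "'s \<Rightarrow> 's pmf"
  assumes x: "x \<noteq> t" "x \<noteq> b" and r: "r x = 0"
  shows "bounded_reward K r t b (Suc n) x = (\<integral>\<^sup>+ y. bounded_reward K r t b n y \<partial>measure_pmf (K x))"
proof -
  define w where "w \<pi> = path_prob K \<pi> * path_reward r \<pi>" for \<pi> :: "'s list"
  define S where "S n s = bounded_visit_paths K t b n s" for n s
  have R: "bounded_reward K r t b n s = (\<integral>\<^sup>+ \<pi>. w \<pi> * indicator (S n s) \<pi> \<partial>count_space UNIV)" for n s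
    by (simp add: bounded_reward_def infsum_ennreal_eq_nn_integral nn_integral_count_space_indicator w_def S_def)
  have hd_S: "\<pi> \<noteq> [] \<and> hd \<pi> = y" if "\<pi> \<in> S n y" for \<pi> n y
    using that by (auto simp: S_def bounded_visit_paths_def first_visit_paths_def)
  \<comment> \<open>Both sides vanish if \<open>hd \<pi>\<close> is not a successor of \<open>x\<close>.\<close>
  have Cons: "w (x # \<pi>) * indicator (S (Suc n) x) (x # \<pi>)
      = ennreal (pmf (K x) (hd \<pi>)) * (w \<pi> * indicator (S n (hd \<pi>)) \<pi>)" for \<pi>
  proof (cases "hd \<pi> \<in> set_pmf (K x) \<and> \<pi> \<noteq> []")
    case True
    then have "x # \<pi> \<in> S (Suc n) x \<longleftrightarrow> \<pi> \<in> S n (hd \<pi>)"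
      using x by (auto simp: S_def bounded_visit_paths_def Cons_first_visit_paths_iff)
    then show ?thesis
      using True r by (simp add: w_def path_prob_Cons path_reward_Cons mult_ac split: split_indicator)
  next
    case False
    then have "x # \<pi> \<notin> S (Suc n) x"
      using x by (auto simp: S_def bounded_visit_paths_def Cons_first_visit_paths_iff)
    moreover have "ennreal (pmf (K x) (hd \<pi>)) = 0 \<or> \<pi> \<notin> S n (hd \<pi>)"
      using False hd_S[of \<pi> n "hd \<pi>"] by (auto simp: set_pmf_iff)
    ultimately show ?thesis by auto
  qed
  have "bounded_reward K r t b (Suc n) x
      = (\<integral>\<^sup>+ \<pi>. w \<pi> * indicator (S (Suc n) x) \<pi> \<partial>count_space (range ((#) x)))"
    unfolding R
  proof (rule nn_integral_count_space_eq)
    fix \<pi> assume "\<pi> \<in> UNIV - range ((#) x)"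
    then have "\<pi> \<notin> S (Suc n) x" using hd_S[of \<pi> "Suc n" x] by (cases \<pi>) auto
    then show "w \<pi> * indicator (S (Suc n) x) \<pi> = 0" by simp
  qed simp
  also have "\<dots> = (\<integral>\<^sup>+ \<pi>. w (x # \<pi>) * indicator (S (Suc n) x) (x # \<pi>) \<partial>count_space UNIV)"
    by (rule nn_integral_bij_count_space[symmetric]) (simp add: bij_betw_def)
  \<comment> \<open>Only y = \<open>hd \<pi>\<close> contributes; the additional sum over y allows
    Tonelli to group the paths by their first state.\<close>
  also have "\<dots> = (\<integral>\<^sup>+ \<pi>. \<integral>\<^sup>+ y. ennreal (pmf (K x) y) * (w \<pi> * indicator (S n y) \<pi>)
      \<partial>count_space UNIV \<partial>count_space UNIV)"
  proof (rule nn_integral_cong)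
    fix \<pi> :: "'s list"
    have "(\<integral>\<^sup>+ y. ennreal (pmf (K x) y) * (w \<pi> * indicator (S n y) \<pi>) \<partial>count_space UNIV)
        = (\<Sum>y\<in>{hd \<pi>}. ennreal (pmf (K x) y) * (w \<pi> * indicator (S n y) \<pi>))"
      using hd_S[of \<pi> n] by (intro nn_integral_count_space') (auto split: split_indicator)
    then show "w (x # \<pi>) * indicator (S (Suc n) x) (x # \<pi>)
        = (\<integral>\<^sup>+ y. ennreal (pmf (K x) y) * (w \<pi> * indicator (S n y) \<pi>) \<partial>count_space UNIV)"
      by (simp add: Cons)
  qed
  also have "\<dots> = (\<integral>\<^sup>+ y. \<integral>\<^sup>+ \<pi>. ennreal (pmf (K x) y) * (w \<pi> * indicator (S n y) \<pi>)
      \<partial>count_space UNIV \<partial>count_space UNIV)"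
    using nn_integral_fst_count_space[of "\<lambda>(\<pi>, y). ennreal (pmf (K x) y) * (w \<pi> * indicator (S n y) \<pi>)"]
      nn_integral_snd_count_space[of "\<lambda>(\<pi>, y). ennreal (pmf (K x) y) * (w \<pi> * indicator (S n y) \<pi>)"]
    by simp
  also have "\<dots> = (\<integral>\<^sup>+ y. ennreal (pmf (K x) y) * bounded_reward K r t b n y \<partial>count_space UNIV)"
    by (simp add: nn_integral_cmult R)
  finally show ?thesis by (simp add: nn_integral_measure_pmf)
qed

section \<open>The Bellman operator of a program\<close>

text \<open>A terminated configuration gets its reward at once, since it can only move on to
  \<open>Sink\<close>, where nothing more is earned. Runs that violate an observation count
  nothing.\<close>

fun bellman :: "('v, 'a) expectation \<Rightarrow> (('v, 'a) config \<Rightarrow> ennreal) \<Rightarrow> ('v, 'a) config \<Rightarrow> ennreal" where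
  "bellman f h (Conf P \<sigma>) = (if P = \<down> then f \<sigma> else \<integral>\<^sup>+ c. h c \<partial>measure_pmf (prog_step P \<sigma>))"
| "bellman f h Bad = 0"
| "bellman f h Sink = 0"

text \<open>\<open>z\<close> is the credit of a run still unfinished after n steps: 0 in the strict
  and 1 in the liberal reading.\<close>

definition approx :: "ennreal \<Rightarrow> ('v, 'a) expectation \<Rightarrow> nat \<Rightarrow> ('v, 'a) config \<Rightarrow> ennreal" where
  "approx z f n = (bellman f ^^ n) (\<lambda>_. z)"

lemma approx_0 [simp]: "approx z f 0 = (\<lambda>_. z)"
  by (simp add: approx_def)

lemma approx_Suc: "approx z f (Suc n) = bellman f (approx z f n)"
  by (simp add: approx_def)

definition exp_reward :: "('v, 'a) expectation \<Rightarrow> ('v, 'a) config \<Rightarrow> ennreal" where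
  "exp_reward f c = (SUP n. approx 0 f n c)"

definition lib_reward :: "('v, 'a) expectation \<Rightarrow> ('v, 'a) config \<Rightarrow> ennreal" where
  "lib_reward f c = (INF n. approx 1 f n c)"

lemma bellman_mono:
  assumes "\<And>\<sigma>. f \<sigma> \<le> g \<sigma>" "\<And>c. h c \<le> k c"
  shows "bellman f h c \<le> bellman g k c"
  using assms by (cases c) (auto intro!: nn_integral_mono)

lemma approx_mono: "(\<And>\<sigma>. f \<sigma> \<le> g \<sigma>) \<Longrightarrow> approx z f n c \<le> approx z g n c"
  by (induction n arbitrary: c) (auto simp: approx_Suc intro!: bellman_mono)

lemma bellman_le_1:
  assumes "g \<in> bounded_expectations" "\<And>c. h c \<le> 1"
  shows "bellman g h c \<le> 1"
proof (cases c)
  case (Conf P \<sigma>)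
  have "(\<integral>\<^sup>+ c. h c \<partial>measure_pmf (prog_step P \<sigma>)) \<le> (\<integral>\<^sup>+ c. 1 \<partial>measure_pmf (prog_step P \<sigma>))"
    using assms by (intro nn_integral_mono) simp
  then show ?thesis using assms Conf by (simp add: bounded_expectations_def)
qed simp_all

lemma incseq_approx: "incseq (\<lambda>n. approx 0 f n)"
proof (rule incseq_SucI)
  show "approx 0 f n \<le> approx 0 f (Suc n)" for n
    by (induction n) (auto simp: approx_Suc le_fun_def intro!: bellman_mono)
qed

text \<open>Boundedness of \<open>g\<close> gives the base case: the first step from the constant 1
  does not rise at terminated configurations.\<close>

lemma decseq_approx:
  assumes "g \<in> bounded_expectations"
  shows "decseq (\<lambda>n. approx 1 g n)"
proof (rule decseq_SucI)
  show "approx 1 g (Suc n) \<le> approx 1 g n" for n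
    by (induction n)
       (auto simp: approx_Suc le_fun_def intro!: bellman_mono bellman_le_1 assms)
qed

lemma approx_le_exp_reward: "approx 0 f n c \<le> exp_reward f c"
  by (auto simp: exp_reward_def intro: SUP_upper)

lemma lib_reward_le_approx: "lib_reward f c \<le> approx 1 f n c"
  by (auto simp: lib_reward_def intro: INF_lower)

lemma lib_reward_le_1: "lib_reward f c \<le> 1"
  using lib_reward_le_approx[of f c 0] by simp

lemma exp_reward_fixpoint: "exp_reward f c = bellman f (exp_reward f) c"
proof (cases c)
  case (Conf P \<sigma>)
  have "exp_reward f c = (SUP n. approx 0 f (Suc n) c)"
    unfolding exp_reward_def
    using incseq_SucD[OF incseq_approx[of f]] by (intro antisym SUP_mono) (auto simp: le_fun_def)
  also have "\<dots> = bellman f (exp_reward f) c"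
    using Conf nn_integral_monotone_convergence_SUP[OF incseq_approx[of f], of "measure_pmf (prog_step P \<sigma>)"]
    by (simp add: approx_Suc exp_reward_def[abs_def])
  finally show ?thesis .
next
  case Bad
  have "approx 0 f n Bad = 0" for n by (cases n) (simp_all add: approx_Suc)
  then show ?thesis using Bad by (simp add: exp_reward_def)
next
  case Sink
  have "approx 0 f n Sink = 0" for n by (cases n) (simp_all add: approx_Suc)
  then show ?thesis using Sink by (simp add: exp_reward_def)
qed

lemma lib_reward_fixpoint:
  assumes g: "g \<in> bounded_expectations"
  shows "lib_reward g c = bellman g (lib_reward g) c"
proof -
  have *: "lib_reward g c = (INF n. approx 1 g (Suc n) c)"
    unfolding lib_reward_def
    using decseq_SucD[OF decseq_approx[OF g]] by (intro antisym INF_mono) (auto simp: le_fun_def)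
  show ?thesis
  proof (cases c)
    case (Conf P \<sigma>)
    \<comment> \<open>Monotone convergence for a decreasing sequence requires a finite integral;
      iterate 0 is the constant 1.\<close>
    have "(\<integral>\<^sup>+ c. approx 1 g 0 c \<partial>measure_pmf (prog_step P \<sigma>)) < \<infinity>"
      by simp
    then show ?thesis
      using Conf * nn_integral_monotone_convergence_INF_decseq[OF decseq_approx[OF g], of "measure_pmf (prog_step P \<sigma>)" 0]
      by (simp add: approx_Suc lib_reward_def[abs_def])
  qed (use * in \<open>simp_all add: approx_Suc\<close>)
qed

lemma exp_reward_simps:
  "exp_reward f (Conf \<down> \<sigma>) = f \<sigma>"
  "P \<noteq> \<down> \<Longrightarrow> exp_reward f (Conf P \<sigma>) = (\<integral>\<^sup>+ c. exp_reward f c \<partial>measure_pmf (prog_step P \<sigma>))"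
  "exp_reward f Bad = 0"
  by (subst exp_reward_fixpoint, simp)+

lemma lib_reward_simps:
  assumes "g \<in> bounded_expectations"
  shows "lib_reward g (Conf \<down> \<sigma>) = g \<sigma>"
    "P \<noteq> \<down> \<Longrightarrow> lib_reward g (Conf P \<sigma>) = (\<integral>\<^sup>+ c. lib_reward g c \<partial>measure_pmf (prog_step P \<sigma>))"
    "lib_reward g Bad = 0"
  by (subst lib_reward_fixpoint[OF assms], simp)+

section \<open>Sequential composition\<close>

text \<open>On the left, n steps must serve both programs together; on the right each of them has n
  steps of its own, and iterates from 0 grow with the number of steps.\<close>

lemma approx_Seq_le:
  "approx 0 f n (append_prog Q c) \<le> approx 0 (\<lambda>\<tau>. approx 0 f n (Conf Q \<tau>)) n c"
proof (induction n arbitrary: c)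
  case (Suc n)
  have inc: "approx 0 f n c \<le> approx 0 f (Suc n) c" for c
    using incseq_SucD[OF incseq_approx[of f], of n] by (simp add: le_fun_def)
  show ?case
  proof (cases c)
    case (Conf P \<sigma>)
    show ?thesis
    proof (cases "P = \<down>")
      case True
      \<comment> \<open>The passage from \<open>\<down>; Q\<close> to \<open>Q\<close> costs a step,
        hence one iterate less on the left.\<close>
      then show ?thesis using Conf inc[of "Conf Q \<sigma>"] by (simp add: approx_Suc)
    next
      case False
      have "approx 0 f n (append_prog Q c) \<le> approx 0 (\<lambda>\<tau>. approx 0 f (Suc n) (Conf Q \<tau>)) n c" for c
        using Suc.IH inc by (rule order_trans[OF _ approx_mono])
      then show ?thesis
        using Conf False
        by (simp add: approx_Suc[of _ "f"] approx_Suc[of _ _ n] nn_integral_mono)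
    qed
  qed (simp_all add: approx_Suc)
qed simp

text \<open>The same comparison of step budgets, reversed because iterates from 1 fall as the number
  of steps grows.\<close>

lemma approx_Seq_ge:
  assumes g: "g \<in> bounded_expectations"
  shows "approx 1 (\<lambda>\<tau>. approx 1 g n (Conf Q \<tau>)) n c \<le> approx 1 g n (append_prog Q c)"
proof (induction n arbitrary: c)
  case (Suc n)
  have dec: "approx 1 g (Suc n) c \<le> approx 1 g n c" for c
    using decseq_SucD[OF decseq_approx[OF g], of n] by (simp add: le_fun_def)
  show ?case
  proof (cases c)
    case (Conf P \<sigma>)
    show ?thesis
    proof (cases "P = \<down>")
      case True
      then show ?thesis using Conf dec[of "Conf Q \<sigma>"] by (simp add: approx_Suc)
    next
      case False
      have "approx 1 (\<lambda>\<tau>. approx 1 g (Suc n) (Conf Q \<tau>)) n c \<le> approx 1 g n (append_prog Q c)" for c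
        using dec Suc.IH by (rule order_trans[OF approx_mono])
      then show ?thesis
        using Conf False
        by (simp add: approx_Suc[of _ "g"] approx_Suc[of _ _ n] nn_integral_mono)
    qed
  qed (simp_all add: approx_Suc)
qed simp

text \<open>One inequality is the comparison of budgets in the limit. For the other, the reward of
  \<open>Q\<close> is already the limit, so each step of \<open>P\<close> is absorbed by the
  fixed-point equation at the composed configuration.\<close>

lemma exp_reward_Seq:
  "exp_reward f (Conf (Seq P Q) \<sigma>) = exp_reward (\<lambda>\<tau>. exp_reward f (Conf Q \<tau>)) (Conf P \<sigma>)"
proof (rule antisym)
  have "approx 0 f n (Conf (Seq P Q) \<sigma>) \<le> exp_reward (\<lambda>\<tau>. exp_reward f (Conf Q \<tau>)) (Conf P \<sigma>)" for n
  proof -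
    have "approx 0 f n (Conf (Seq P Q) \<sigma>) \<le> approx 0 (\<lambda>\<tau>. approx 0 f n (Conf Q \<tau>)) n (Conf P \<sigma>)"
      using approx_Seq_le[of f n Q "Conf P \<sigma>"] by simp
    also have "\<dots> \<le> approx 0 (\<lambda>\<tau>. exp_reward f (Conf Q \<tau>)) n (Conf P \<sigma>)"
      by (intro approx_mono approx_le_exp_reward)
    also have "\<dots> \<le> exp_reward (\<lambda>\<tau>. exp_reward f (Conf Q \<tau>)) (Conf P \<sigma>)"
      by (rule approx_le_exp_reward)
    finally show ?thesis .
  qed
  then show "exp_reward f (Conf (Seq P Q) \<sigma>) \<le> exp_reward (\<lambda>\<tau>. exp_reward f (Conf Q \<tau>)) (Conf P \<sigma>)"
    by (subst exp_reward_def) (rule SUP_least)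
next
  have "approx 0 (\<lambda>\<tau>. exp_reward f (Conf Q \<tau>)) n c \<le> exp_reward f (append_prog Q c)" for n c
  proof (induction n arbitrary: c)
    case (Suc n)
    show ?case
    proof (cases c)
      case (Conf P \<sigma>)
      then show ?thesis
        using Suc.IH by (simp add: approx_Suc exp_reward_simps nn_integral_mono)
    qed (simp_all add: approx_Suc)
  qed simp
  from this[of _ "Conf P \<sigma>"]
  show "exp_reward (\<lambda>\<tau>. exp_reward f (Conf Q \<tau>)) (Conf P \<sigma>) \<le> exp_reward f (Conf (Seq P Q) \<sigma>)"
    by (subst exp_reward_def) (simp add: SUP_least)
qed

lemma lib_reward_Seq:
  assumes g: "g \<in> bounded_expectations"
  shows "lib_reward g (Conf (Seq P Q) \<sigma>) = lib_reward (\<lambda>\<tau>. lib_reward g (Conf Q \<tau>)) (Conf P \<sigma>)"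
proof (rule antisym)
  have "lib_reward (\<lambda>\<tau>. lib_reward g (Conf Q \<tau>)) (Conf P \<sigma>) \<le> approx 1 g n (Conf (Seq P Q) \<sigma>)" for n
  proof -
    have "lib_reward (\<lambda>\<tau>. lib_reward g (Conf Q \<tau>)) (Conf P \<sigma>) \<le> approx 1 (\<lambda>\<tau>. lib_reward g (Conf Q \<tau>)) n (Conf P \<sigma>)"
      by (rule lib_reward_le_approx)
    also have "\<dots> \<le> approx 1 (\<lambda>\<tau>. approx 1 g n (Conf Q \<tau>)) n (Conf P \<sigma>)"
      by (intro approx_mono lib_reward_le_approx)
    also have "\<dots> \<le> approx 1 g n (Conf (Seq P Q) \<sigma>)"
      using approx_Seq_ge[OF g, of n Q "Conf P \<sigma>"] by simp
    finally show ?thesis .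
  qed
  then show "lib_reward (\<lambda>\<tau>. lib_reward g (Conf Q \<tau>)) (Conf P \<sigma>) \<le> lib_reward g (Conf (Seq P Q) \<sigma>)"
    by (subst (3) lib_reward_def) (rule INF_greatest)
next
  have "lib_reward g (append_prog Q c) \<le> approx 1 (\<lambda>\<tau>. lib_reward g (Conf Q \<tau>)) n c" for n c
  proof (induction n arbitrary: c)
    case 0
    show ?case by (simp add: lib_reward_le_1)
  next
    case (Suc n)
    show ?case
    proof (cases c)
      case (Conf P \<sigma>)
      then show ?thesis
        using Suc.IH by (simp add: approx_Suc lib_reward_simps[OF g] nn_integral_mono)
    next
      case Sink
      then show ?thesis using lib_reward_fixpoint[OF g, of Sink] by (simp add: approx_Suc)
    qed (simp_all add: approx_Suc lib_reward_simps[OF g])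
  qed
  from this[of "Conf P \<sigma>"]
  show "lib_reward g (Conf (Seq P Q) \<sigma>) \<le> lib_reward (\<lambda>\<tau>. lib_reward g (Conf Q \<tau>)) (Conf P \<sigma>)"
    by (subst (2) lib_reward_def) (simp add: INF_greatest)
qed

section \<open>Loops\<close>

lemma exp_reward_While_unfold:
  "exp_reward f (Conf (While G P) \<sigma>)
    = (if G \<sigma> then exp_reward (\<lambda>\<tau>. exp_reward f (Conf (While G P) \<tau>)) (Conf P \<sigma>) else f \<sigma>)"
  by (simp add: exp_reward_simps(2)[of "While G P"] exp_reward_simps(1) exp_reward_Seq)

text \<open>Park induction: one unfolding leaves n steps for the body followed by the loop,
  \<open>approx_Seq_le\<close> grants n steps to each, and the induction hypothesis replaces the
  inner loop by \<open>X\<close>.\<close>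

lemma exp_reward_While_least:
  assumes X: "\<And>\<sigma>. (if G \<sigma> then exp_reward X (Conf P \<sigma>) else f \<sigma>) \<le> X \<sigma>"
  shows "exp_reward f (Conf (While G P) \<sigma>) \<le> X \<sigma>"
proof -
  have "approx 0 f n (Conf (While G P) \<sigma>) \<le> X \<sigma>" for n \<sigma>
  proof (induction n arbitrary: \<sigma>)
    case (Suc n)
    have "approx 0 f n (Conf (Seq P (While G P)) \<sigma>) \<le> exp_reward X (Conf P \<sigma>)"
    proof -
      have "approx 0 f n (Conf (Seq P (While G P)) \<sigma>)
          \<le> approx 0 (\<lambda>\<tau>. approx 0 f n (Conf (While G P) \<tau>)) n (Conf P \<sigma>)"
        using approx_Seq_le[of f n "While G P" "Conf P \<sigma>"] by simp
      also have "\<dots> \<le> approx 0 X n (Conf P \<sigma>)"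
        by (intro approx_mono Suc.IH)
      also have "\<dots> \<le> exp_reward X (Conf P \<sigma>)"
        by (rule approx_le_exp_reward)
      finally show ?thesis .
    qed
    \<comment> \<open>Only an inequality, as iterate 0 is 0 even at a terminated
      configuration.\<close>
    moreover have "approx 0 f n (Conf \<down> \<sigma>) \<le> f \<sigma>"
      using approx_le_exp_reward[of f n "Conf \<down> \<sigma>"] by (simp add: exp_reward_simps)
    ultimately show ?case
      using X[of \<sigma>] by (auto simp: approx_Suc split: if_splits)
  qed simp
  then show ?thesis unfolding exp_reward_def by (intro SUP_least)
qed

lemma lib_reward_While_unfold:
  assumes g: "g \<in> bounded_expectations"
  shows "lib_reward g (Conf (While G P) \<sigma>)
    = (if G \<sigma> then lib_reward (\<lambda>\<tau>. lib_reward g (Conf (While G P) \<tau>)) (Conf P \<sigma>) else g \<sigma>)"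
  by (simp add: lib_reward_simps(2)[OF g, of "While G P"] lib_reward_simps(1)[OF g] lib_reward_Seq[OF g])

text \<open>The dual induction; it starts because \<open>X\<close> is bounded by 1, the value of
  iterate 0.\<close>

lemma lib_reward_While_greatest:
  assumes g: "g \<in> bounded_expectations" and X1: "X \<in> bounded_expectations"
    and X: "\<And>\<sigma>. X \<sigma> \<le> (if G \<sigma> then lib_reward X (Conf P \<sigma>) else g \<sigma>)"
  shows "X \<sigma> \<le> lib_reward g (Conf (While G P) \<sigma>)"
proof -
  have "X \<sigma> \<le> approx 1 g n (Conf (While G P) \<sigma>)" for n \<sigma>
  proof (induction n arbitrary: \<sigma>)
    case (Suc n)
    have "lib_reward X (Conf P \<sigma>) \<le> approx 1 g n (Conf (Seq P (While G P)) \<sigma>)"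
    proof -
      have "lib_reward X (Conf P \<sigma>) \<le> approx 1 X n (Conf P \<sigma>)"
        by (rule lib_reward_le_approx)
      also have "\<dots> \<le> approx 1 (\<lambda>\<tau>. approx 1 g n (Conf (While G P) \<tau>)) n (Conf P \<sigma>)"
        by (intro approx_mono Suc.IH)
      also have "\<dots> \<le> approx 1 g n (Conf (Seq P (While G P)) \<sigma>)"
        using approx_Seq_ge[OF g, of n "While G P" "Conf P \<sigma>"] by simp
      finally show ?thesis .
    qed
    moreover have "g \<sigma> \<le> approx 1 g n (Conf \<down> \<sigma>)"
      using lib_reward_le_approx[of g "Conf \<down> \<sigma>" n] by (simp add: lib_reward_simps[OF g])
    ultimately show ?case
      using X[of \<sigma>] by (auto simp: approx_Suc split: if_splits)
  qed (use X1 in \<open>simp add: bounded_expectations_def\<close>)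
  then show ?thesis unfolding lib_reward_def by (intro INF_greatest)
qed

section \<open>Expected rewards as limits of Bellman iterates\<close>

lemma Sink_notin_prog_step: "P \<noteq> \<down> \<Longrightarrow> Sink \<notin> set_pmf (prog_step P \<sigma>)"
proof (induction P arbitrary: \<sigma>)
  case (Seq P Q)
  have "Sink = append_prog Q c \<longleftrightarrow> Sink = c" for c :: "('a, 'b) config"
    by (cases c) simp_all
  then show ?case using Seq.IH(1)[of \<sigma>] by (simp add: image_iff)
qed (auto split: if_splits)

text \<open>The comparisons of iterates below can fail at \<open>Sink\<close>; this allows their use
  under the integral over successors.\<close>

lemma nn_integral_prog_step_cong:
  assumes "P \<noteq> \<down>" "\<And>c. c \<noteq> Sink \<Longrightarrow> h c = k c"
  shows "(\<integral>\<^sup>+ c. h c \<partial>measure_pmf (prog_step P \<sigma>)) = (\<integral>\<^sup>+ c. k c \<partial>measure_pmf (prog_step P \<sigma>))"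
  using Sink_notin_prog_step[OF assms(1), of \<sigma>]
  by (intro nn_integral_cong_AE) (auto simp: AE_measure_pmf_iff intro!: assms(2))

text \<open>Both indices count transitions: a terminated configuration earns its reward on the move
  to \<open>Sink\<close>, and every other program configuration earns nothing and is averaged over
  its successors.\<close>

lemma bounded_reward_eq_approx:
  "bounded_reward config_step (reward f) Sink Bad n c = approx 0 f n c"
proof (induction n arbitrary: c)
  case 0
  show ?case by (simp add: bounded_reward_0)
next
  case (Suc n)
  show ?case
  proof (cases c)
    case (Conf P \<sigma>)
    then show ?thesis
      by (cases "P = \<down>") (simp_all add: bounded_reward_exit bounded_reward_step Suc.IH approx_Suc)
  qed (simp_all add: bounded_reward_avoided bounded_reward_target approx_Suc)
qed

lemma avoid_step_iter_simps:
  "(avoid_step K t ^^ Suc n) h x = (if x = t then 0 else \<integral>\<^sup>+ y. (avoid_step K t ^^ n) h y \<partial>measure_pmf (K x))"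
  by (simp add: avoid_step_def)

text \<open>The index is shifted because the avoidance probability sees \<open>bad\<close> one step earlier: its
  iterate 0 vanishes there, whereas the Bellman iteration starts from 1 at every state.\<close>

lemma avoid_Bad_eq_approx:
  "c \<noteq> Sink \<Longrightarrow>
    (avoid_step config_step Bad ^^ n) (\<lambda>x. of_bool (x \<noteq> Bad)) c = approx 1 (\<lambda>_. 1) (Suc n) c"
proof (induction n arbitrary: c)
  case 0
  then show ?case by (cases c) (simp_all add: approx_Suc)
next
  case (Suc n)
  \<comment> \<open>At \<open>Sink\<close> avoidance is certain, while \<open>bellman\<close> yields
    0 there. The value 1 is what a terminated configuration receives from its successor.\<close>
  have Sink: "(avoid_step config_step Bad ^^ n) (\<lambda>x. of_bool (x \<noteq> Bad)) Sink = 1" for n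
    by (induction n) (simp_all add: avoid_step_iter_simps del: funpow.simps(2))
  show ?case
  proof (cases c)
    case (Conf P \<sigma>)
    then show ?thesis
      using nn_integral_prog_step_cong[OF _ Suc.IH]
      by (cases "P = \<down>")
         (simp_all add: avoid_step_iter_simps Sink approx_Suc[of _ _ "Suc n"] del: funpow.simps(2))
  next
    case Bad
    then show ?thesis by (simp add: avoid_step_def approx_Suc)
  qed (use Suc.prems in simp)
qed

text \<open>The starting values differ by 1, and exactly the runs that have not reached
  \<open>Sink\<close> after n transitions collect this difference.\<close>

lemma approx_1_eq_approx_0_plus_avoid_Sink:
  "c \<noteq> Sink \<Longrightarrow>
    approx 1 g n c = approx 0 g n c + (avoid_step config_step Sink ^^ n) (\<lambda>x. of_bool (x \<noteq> Sink)) c"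
proof (induction n arbitrary: c)
  case (Suc n)
  have Sink: "(avoid_step config_step Sink ^^ n) (\<lambda>x. of_bool (x \<noteq> Sink)) Sink = 0" for n
    by (induction n) (simp_all add: avoid_step_def)
  show ?case
  proof (cases c)
    case (Conf P \<sigma>)
    then show ?thesis
      using nn_integral_prog_step_cong[OF _ Suc.IH]
      by (cases "P = \<down>")
         (simp_all add: avoid_step_iter_simps Sink approx_Suc nn_integral_add del: funpow.simps(2))
  next
    case Bad
    then show ?thesis
      by (simp add: avoid_step_iter_simps Sink approx_Suc del: funpow.simps(2))
  qed (use Suc.prems in simp)
qed simp

section \<open>Passage to the limit\<close>

lemma decseq_avoid_step:
  "decseq (\<lambda>n. (avoid_step K t ^^ n) (\<lambda>x. of_bool (x \<noteq> t)) s)"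
proof -
  have "(avoid_step K t ^^ Suc n) (\<lambda>x. of_bool (x \<noteq> t)) s \<le> (avoid_step K t ^^ n) (\<lambda>x. of_bool (x \<noteq> t)) s" for n s
  proof (induction n arbitrary: s)
    case 0
    have "(\<integral>\<^sup>+ y. of_bool (y \<noteq> t) \<partial>measure_pmf (K s)) \<le> (\<integral>\<^sup>+ y. 1 \<partial>measure_pmf (K s))"
      by (intro nn_integral_mono) simp
    then show ?case by (simp add: avoid_step_def)
  next
    case (Suc n)
    then show ?case
      unfolding avoid_step_iter_simps[of _ _ "Suc n"] avoid_step_iter_simps[of _ _ n]
      by (auto intro!: nn_integral_mono simp: avoid_step_iter_simps simp del: funpow.simps(2))
  qed
  then show ?thesis by (intro decseq_SucI)
qed

lemma pr_never_Bad: "pr_never config_step (Conf P \<sigma>) Bad = lib_reward (\<lambda>_. 1) (Conf P \<sigma>)"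
proof -
  have "(INF n. approx 1 (\<lambda>_. 1) (Suc n) (Conf P \<sigma>)) = lib_reward (\<lambda>_. 1) (Conf P \<sigma>)"
    unfolding lib_reward_def
    using decseq_SucD[OF decseq_approx[of "\<lambda>_. 1"]]
    by (intro antisym INF_mono) (auto simp: le_fun_def bounded_expectations_def)
  then show ?thesis by (simp add: pr_never_eq_INF avoid_Bad_eq_approx)
qed

text \<open>An increasing and a decreasing sequence are added, so the argument uses limits in place
  of a supremum and an infimum.\<close>

lemma exp_reward_plus_pr_never_Sink:
  assumes g: "g \<in> bounded_expectations"
  shows "exp_reward g (Conf P \<sigma>) + pr_never config_step (Conf P \<sigma>) Sink = lib_reward g (Conf P \<sigma>)"
proof (rule LIMSEQ_unique)
  let ?D = "\<lambda>n. (avoid_step config_step Sink ^^ n) (\<lambda>x. of_bool (x \<noteq> Sink)) (Conf P \<sigma>)"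
  have "(\<lambda>n. approx 0 g n (Conf P \<sigma>)) \<longlonglongrightarrow> exp_reward g (Conf P \<sigma>)"
    unfolding exp_reward_def
    using incseq_SucD[OF incseq_approx[of g]] by (intro LIMSEQ_SUP incseq_SucI) (auto simp: le_fun_def)
  moreover have "?D \<longlonglongrightarrow> pr_never config_step (Conf P \<sigma>) Sink"
    unfolding pr_never_eq_INF by (intro LIMSEQ_INF decseq_avoid_step)
  ultimately show "(\<lambda>n. approx 1 g n (Conf P \<sigma>))
      \<longlonglongrightarrow> exp_reward g (Conf P \<sigma>) + pr_never config_step (Conf P \<sigma>) Sink"
    by (simp add: approx_1_eq_approx_0_plus_avoid_Sink tendsto_add)
  show "(\<lambda>n. approx 1 g n (Conf P \<sigma>)) \<longlonglongrightarrow> lib_reward g (Conf P \<sigma>)"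
    unfolding lib_reward_def
    using decseq_SucD[OF decseq_approx[OF g]] by (intro LIMSEQ_INF decseq_SucI) (auto simp: le_fun_def)
qed

lemma CExpRew_eq:
  "CExpRew config_step (reward f) (Conf P \<sigma>) Sink Bad
    = quotient (exp_reward f (Conf P \<sigma>)) (lib_reward (\<lambda>_. 1) (Conf P \<sigma>))"
  by (simp add: CExpRew_def bounded_reward_SUP bounded_reward_eq_approx exp_reward_def pr_never_Bad)

lemma CLExpRew_eq:
  assumes "g \<in> bounded_expectations"
  shows "CLExpRew config_step (reward g) (Conf P \<sigma>) Sink Bad
    = quotient (lib_reward g (Conf P \<sigma>)) (lib_reward (\<lambda>_. 1) (Conf P \<sigma>))"
  by (simp add: CLExpRew_def bounded_reward_SUP bounded_reward_eq_approx
      exp_reward_plus_pr_never_Sink[OF assms, symmetric] exp_reward_def pr_never_Bad)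

section \<open>The transformers as limits of Bellman iterates\<close>

text \<open>Antisymmetry of \<open>le\<close> gives the uniqueness that the definite description
  requires.\<close>

lemma least_fixpoint_eqI:
  assumes "h \<in> A" "F h = h" "\<And>h'. h' \<in> A \<Longrightarrow> F h' = h' \<Longrightarrow> le h h'"
    and "\<And>h h'. le h h' \<Longrightarrow> le h' h \<Longrightarrow> h = h'"
  shows "least_fixpoint A le F = h"
  unfolding least_fixpoint_def by (rule the_equality) (use assms in blast)+

lemma greatest_fixpoint_eqI:
  assumes "h \<in> A" "F h = h" "\<And>h'. h' \<in> A \<Longrightarrow> F h' = h' \<Longrightarrow> le h' h"
    and "\<And>h h'. le h h' \<Longrightarrow> le h' h \<Longrightarrow> h = h'"
  shows "greatest_fixpoint A le F = h"
  unfolding greatest_fixpoint_def by (rule the_equality) (use assms in blast)+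

text \<open>In \<open>ennreal\<close>, 0 times infinity is 0, so the branch not taken vanishes even
  where its value is infinite.\<close>

lemma guarded_sum_eq:
  "add2 (scale2 (chi G) h) (scale2 (chi (\<lambda>\<sigma>. \<not> G \<sigma>)) k)
    = (\<lambda>\<sigma>. if G \<sigma> then fst h \<sigma> else fst k \<sigma>, \<lambda>\<sigma>. if G \<sigma> then snd h \<sigma> else snd k \<sigma>)"
  by (auto simp: add2_def scale2_def chi_def fun_eq_iff)

text \<open>The fixed-point equation says nothing at \<open>abort\<close>, which is its own only successor, so the
  iterates themselves are needed.\<close>

lemma exp_reward_Abort: "exp_reward f (Conf Abort \<sigma>) = 0"
proof -
  have "approx 0 f n (Conf Abort \<sigma>) = 0" for n by (induction n) (simp_all add: approx_Suc)
  then show ?thesis by (simp add: exp_reward_def)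
qed

lemma lib_reward_Abort: "lib_reward g (Conf Abort \<sigma>) = 1"
proof -
  have "approx 1 g n (Conf Abort \<sigma>) = 1" for n by (induction n) (simp_all add: approx_Suc)
  then show ?thesis by (simp add: lib_reward_def)
qed

lemma lib_reward_bounded: "(\<lambda>\<sigma>. lib_reward g (Conf P \<sigma>)) \<in> bounded_expectations"
  by (simp add: bounded_expectations_def lib_reward_le_1)

text \<open>The transformers act on the two components separately. The order for \<open>cwp\<close>
  is reversed in the second component, which is therefore liberal for both transformers.\<close>

lemma cwp_cwlp_eq:
  assumes "P \<in> cpGCL"
  shows "(\<forall>h \<in> UNIV \<times> bounded_expectations. cwp P h =
      (\<lambda>\<sigma>. exp_reward (fst h) (Conf P \<sigma>), \<lambda>\<sigma>. lib_reward (snd h) (Conf P \<sigma>))) \<and>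
    (\<forall>h \<in> bounded_expectations \<times> bounded_expectations. cwlp P h =
      (\<lambda>\<sigma>. lib_reward (fst h) (Conf P \<sigma>), \<lambda>\<sigma>. lib_reward (snd h) (Conf P \<sigma>)))"
  using assms
proof induction
  case 1
  show ?case by (auto simp: exp_reward_simps lib_reward_simps)
next
  case 2
  show ?case by (auto simp: exp_reward_Abort lib_reward_Abort)
next
  case (3 x E)
  show ?case by (auto simp: exp_reward_simps lib_reward_simps subst_def)
next
  case (4 G)
  show ?case by (auto simp: exp_reward_simps lib_reward_simps scale2_def chi_def fun_eq_iff)
next
  case (5 P Q)
  then show ?case by (auto simp: exp_reward_Seq lib_reward_Seq lib_reward_bounded)
next
  case (6 P Q G)
  then show ?case
    by (auto simp: guarded_sum_eq exp_reward_simps(2)[of "Ite G P Q"] lib_reward_simps(2)[of _ "Ite G P Q"])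
next
  case (7 P Q p)
  then show ?case
    by (auto simp: add2_def scale2_def exp_reward_simps(2)[of "PChoice P p Q"]
        lib_reward_simps(2)[of _ "PChoice P p Q"] mult.commute)
next
  case (8 P G)
  show ?case
  proof (intro conjI ballI)
    fix h :: "('a, 'b) expectation \<times> ('a, 'b) expectation"
    assume h: "h \<in> UNIV \<times> bounded_expectations"
    then have g: "snd h \<in> bounded_expectations" by auto
    \<comment> \<open>The induction hypothesis rewrites the loop functional on bounded pairs only,
      which is where the candidate \<open>?L\<close> and its competitors \<open>X\<close>
      lie.\<close>
    have F: "add2 (scale2 (chi G) (cwp P X)) (scale2 (chi (\<lambda>\<sigma>. \<not> G \<sigma>)) h)
      = (\<lambda>\<sigma>. if G \<sigma> then exp_reward (fst X) (Conf P \<sigma>) else fst h \<sigma>,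
         \<lambda>\<sigma>. if G \<sigma> then lib_reward (snd X) (Conf P \<sigma>) else snd h \<sigma>)"
      if "X \<in> UNIV \<times> bounded_expectations" for X
      using 8 that by (auto simp: guarded_sum_eq)
    show "cwp (While G P) h = (\<lambda>\<sigma>. exp_reward (fst h) (Conf (While G P) \<sigma>),
        \<lambda>\<sigma>. lib_reward (snd h) (Conf (While G P) \<sigma>))" (is "_ = ?L")
      unfolding cwp.simps
    proof (rule least_fixpoint_eqI)
      show L: "?L \<in> UNIV \<times> bounded_expectations" by (simp add: lib_reward_bounded)
      show "add2 (scale2 (chi G) (cwp P ?L)) (scale2 (chi (\<lambda>\<sigma>. \<not> G \<sigma>)) h) = ?L"
        unfolding F[OF L] fst_conv snd_conv
        by (intro arg_cong2[where f=Pair] ext exp_reward_While_unfold[symmetric] lib_reward_While_unfold[OF g, symmetric])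
    next
      fix X assume X: "X \<in> UNIV \<times> (bounded_expectations :: ('a, 'b) expectation set)"
        and "add2 (scale2 (chi G) (cwp P X)) (scale2 (chi (\<lambda>\<sigma>. \<not> G \<sigma>)) h) = X"
      then have eq: "(if G \<sigma> then exp_reward (fst X) (Conf P \<sigma>) else fst h \<sigma>) = fst X \<sigma>"
        "(if G \<sigma> then lib_reward (snd X) (Conf P \<sigma>) else snd h \<sigma>) = snd X \<sigma>" for \<sigma>
        unfolding F[OF X] prod_eq_iff fun_eq_iff fst_conv snd_conv by blast+
      \<comment> \<open>A fixed point is in particular a prefixed point in its first component and a
        postfixed point in its second.\<close>
      have "exp_reward (fst h) (Conf (While G P) \<sigma>) \<le> fst X \<sigma>" for \<sigma>
        by (rule exp_reward_While_least) (simp only: eq order_refl)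
      moreover have "snd X \<sigma> \<le> lib_reward (snd h) (Conf (While G P) \<sigma>)" for \<sigma>
        by (rule lib_reward_While_greatest[OF g]) (use X in \<open>auto simp only: eq order_refl mem_Times_iff\<close>)
      ultimately show "le_cwp ?L X"
        by (simp add: le_cwp_def le_fun_def)
    qed (auto simp: le_cwp_def prod_eq_iff)
  next
    fix h :: "('a, 'b) expectation \<times> ('a, 'b) expectation"
    assume h: "h \<in> bounded_expectations \<times> bounded_expectations"
    then have g: "fst h \<in> bounded_expectations" "snd h \<in> bounded_expectations" by auto
    have F: "add2 (scale2 (chi G) (cwlp P X)) (scale2 (chi (\<lambda>\<sigma>. \<not> G \<sigma>)) h)
      = (\<lambda>\<sigma>. if G \<sigma> then lib_reward (fst X) (Conf P \<sigma>) else fst h \<sigma>,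
         \<lambda>\<sigma>. if G \<sigma> then lib_reward (snd X) (Conf P \<sigma>) else snd h \<sigma>)"
      if "X \<in> bounded_expectations \<times> bounded_expectations" for X
      using 8 that by (auto simp: guarded_sum_eq)
    show "cwlp (While G P) h = (\<lambda>\<sigma>. lib_reward (fst h) (Conf (While G P) \<sigma>),
        \<lambda>\<sigma>. lib_reward (snd h) (Conf (While G P) \<sigma>))" (is "_ = ?L")
      unfolding cwlp.simps
    proof (rule greatest_fixpoint_eqI)
      show L: "?L \<in> bounded_expectations \<times> bounded_expectations" by (simp add: lib_reward_bounded)
      show "add2 (scale2 (chi G) (cwlp P ?L)) (scale2 (chi (\<lambda>\<sigma>. \<not> G \<sigma>)) h) = ?L"
        unfolding F[OF L] fst_conv snd_conv
        by (intro arg_cong2[where f=Pair] ext g[THEN lib_reward_While_unfold, symmetric])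
    next
      fix X assume X: "X \<in> bounded_expectations \<times> (bounded_expectations :: ('a, 'b) expectation set)"
        and "add2 (scale2 (chi G) (cwlp P X)) (scale2 (chi (\<lambda>\<sigma>. \<not> G \<sigma>)) h) = X"
      then have eq: "(if G \<sigma> then lib_reward (fst X) (Conf P \<sigma>) else fst h \<sigma>) = fst X \<sigma>"
        "(if G \<sigma> then lib_reward (snd X) (Conf P \<sigma>) else snd h \<sigma>) = snd X \<sigma>" for \<sigma>
        unfolding F[OF X] prod_eq_iff fun_eq_iff fst_conv snd_conv by blast+
      have "fst X \<sigma> \<le> lib_reward (fst h) (Conf (While G P) \<sigma>)" for \<sigma>
        by (rule lib_reward_While_greatest[OF g(1)]) (use X in \<open>auto simp only: eq order_refl mem_Times_iff\<close>)
      moreover have "snd X \<sigma> \<le> lib_reward (snd h) (Conf (While G P) \<sigma>)" for \<sigma>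
        by (rule lib_reward_While_greatest[OF g(2)]) (use X in \<open>auto simp only: eq order_refl mem_Times_iff\<close>)
      ultimately show "le_cwlp X ?L"
        by (simp add: le_cwlp_def le_fun_def)
    qed (auto simp: le_cwlp_def prod_eq_iff)
  qed
qed

theorem theoremV6:
  fixes P :: "('v, 'a) prog"
    and f g :: "('v, 'a) expectation"
    and \<sigma> :: "('v, 'a) state"
  assumes "P \<in> cpGCL"
    and "g \<in> bounded_expectations"
  shows "CExpRew config_step (reward f) (Conf P \<sigma>) Sink Bad = ucwp P f \<sigma>
       \<and> CLExpRew config_step (reward g) (Conf P \<sigma>) Sink Bad = ucwlp P g \<sigma>"
proof -
  \<comment> \<open>The transformers are applied to pairs with second component 1, so all
    denominators become \<open>lib_reward (\<lambda>_. 1)\<close>, and the quotients are undefined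
    simultaneously.\<close>
  have "(\<lambda>_. 1) \<in> (bounded_expectations :: ('v, 'a) expectation set)"
    by (simp add: bounded_expectations_def)
  then show ?thesis
    using cwp_cwlp_eq[OF assms(1)] assms(2)
    by (simp add: CExpRew_eq CLExpRew_eq ucwp_def ucwlp_def)
qed

end
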